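(* For every $\zeta,\epsilon>0$ there is $\eta>0$ such that the following holds for any $\rho,p\in[\zeta,1-\zeta]$ and $\lambda\ge\rho+\zeta$. If $f\colon(\{0,1\}^n,\mu_{\rho p})\to[0,1]$ and $g\colon(\{0,1\}^n,\mu_p)\to\{0,1\}$ satisfy $\|\mathrm{T}^{p}_{\rho p}f-\lambda g\|_1\le\eta$, then $g$ is $\epsilon$-close to a constant function $\Gamma\in\{0,1\}$, and $\big|\mathbb{E}_{\mathbf{x}\sim\mu_{\rho p}}[f(\mathbf{x})]-\lambda\Gamma\big|\le\epsilon$.
   Context: $\mu_q$ is the $q$-biased product measure on $\{0,1\}^n$. $\mathrm{T}^{p}_{\rho p}f(x)=\mathbb{E}_{\mathbf{z}\sim\mu_\rho}[f(x\wedge\mathbf{z})]$ (coordinatewise AND). $\|\cdot\|_1$ is the $L_1$ norm with respect to $\mu_p$; $g$ being $\epsilon$-close to $\Gamma$ means $\Pr_{\mathbf{x}\sim\mu_p}[g(\mathbf{x})\ne\Gamma]\le\epsilon$. *)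

theory Defs
  imports "HOL-Probability.Probability" "HOL-Probability.Product_PMF"
begin

text \<open>
  The dimension \<open>n\<close> must be quantified inside the statement (the closeness parameter may not
  depend on it), so points of the cube are functions on the natural numbers that are
  \<^const>\<open>False\<close> outside \<open>{..<n}\<close>, with \<^const>\<open>True\<close> for 1 and \<^const>\<open>False\<close> for 0.
\<close>

definition cube :: "nat \<Rightarrow> (nat \<Rightarrow> bool) set" where
  "cube n = PiE_dflt {..<n} False (\<lambda>_. UNIV)"

text \<open>
  All probabilities and expectations below are taken with respect to \<open>biased n q\<close>, whose support
  is contained in \<open>cube n\<close>; values of functions outside the cube are thus irrelevant.
  \<^const>\<open>bernoulli_pmf\<close> truncates its parameter to the unit interval.
\<close>

definition biased :: "nat \<Rightarrow> real \<Rightarrow> (nat \<Rightarrow> bool) pmf" where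
  "biased n q = Pi_pmf {..<n} False (\<lambda>_. bernoulli_pmf q)"

definition expect :: "nat \<Rightarrow> real \<Rightarrow> ((nat \<Rightarrow> bool) \<Rightarrow> real) \<Rightarrow> real" where
  "expect n q h = measure_pmf.expectation (biased n q) h"

text \<open>
  The one-sided noise operator from functions on the cube with bias \<open>\<rho> * p\<close> to functions on the
  cube with bias \<open>p\<close>; as a map on functions it depends only on \<open>\<rho>\<close>.
\<close>

definition and_noise ::
    "nat \<Rightarrow> real \<Rightarrow> ((nat \<Rightarrow> bool) \<Rightarrow> real) \<Rightarrow> (nat \<Rightarrow> bool) \<Rightarrow> real" where
  "and_noise n \<rho> f x = expect n \<rho> (\<lambda>z. f (\<lambda>i. x i \<and> z i))"

definition L1_norm :: "nat \<Rightarrow> real \<Rightarrow> ((nat \<Rightarrow> bool) \<Rightarrow> real) \<Rightarrow> real" where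
  "L1_norm n p h = expect n p (\<lambda>x. \<bar>h x\<bar>)"

definition close_to_const ::
    "nat \<Rightarrow> real \<Rightarrow> real \<Rightarrow> ((nat \<Rightarrow> bool) \<Rightarrow> real) \<Rightarrow> real \<Rightarrow> bool" where
  "close_to_const n p \<epsilon> g \<Gamma> \<longleftrightarrow> measure_pmf.prob (biased n p) {x. g x \<noteq> \<Gamma>} \<le> \<epsilon>"

end

theory Submission
  imports Defs
begin

text \<open>
  Write \<open>F\<close> for the noisy version of \<open>f\<close>, and for an edge of the cube with upper endpoint \<open>x\<close> and
  lower endpoint \<open>y\<close> write \<open>F x = (1 - \<rho>) * F y + \<rho> * b\<close> with \<open>b\<close> in the unit interval. If
  \<open>F x\<close> is nearly \<open>0\<close>, so is \<open>F y\<close>; if \<open>F x\<close> is nearly \<open>lam\<close>, then \<open>F y\<close> is at least nearly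
  \<open>lam - \<rho> \<ge> \<zeta>\<close>. Hence, with a Lipschitz cutoff separating \<open>0\<close> from \<open>\<zeta>\<close>, the function
  \<open>cutoff \<zeta> F\<close> only varies along edges whose upper endpoint is bad, meaning that \<open>F\<close> is not close
  to \<open>lam * g\<close> there. Moreover, the downward derivatives of \<open>F\<close> at any fixed point are first-order
  Fourier coefficients of a function bounded by 1, so by Bessel's inequality the sum of their
  squares is at most \<open>\<rho> / (1 - \<rho>)\<close>. The Efron--Stein inequality then bounds the variance of
  \<open>cutoff \<zeta> F\<close> by a constant times the probability of the bad points, which is small by Markov's
  inequality. Since \<open>cutoff \<zeta> F\<close> agrees with \<open>g\<close> at all other points, \<open>g\<close> has small variance.
\<close>

section \<open>Expectations under biased product measures\<close>

text \<open>Any finite index set of any type is allowed, so that inequalities can be proved by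
  inserting one coordinate at a time; \<open>expect n\<close> is the case
  \<open>{..<n}\<close>.\<close>

definition pexpect :: "'i set \<Rightarrow> real \<Rightarrow> (('i \<Rightarrow> bool) \<Rightarrow> real) \<Rightarrow> real" where
  "pexpect A q h = measure_pmf.expectation (Pi_pmf A False (\<lambda>_. bernoulli_pmf q)) h"

definition pvar :: "'i set \<Rightarrow> real \<Rightarrow> (('i \<Rightarrow> bool) \<Rightarrow> real) \<Rightarrow> real" where
  "pvar A q h = pexpect A q (\<lambda>x. (h x)\<^sup>2) - (pexpect A q h)\<^sup>2"

lemma integrable_Pi_bernoulli:
  fixes h :: "('i \<Rightarrow> bool) \<Rightarrow> real"
  assumes "finite A"
  shows "integrable (measure_pmf (Pi_pmf A False (\<lambda>_. bernoulli_pmf q))) h"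
proof (rule integrable_measure_pmf_finite)
  have "finite (PiE_dflt A False (\<lambda>_. UNIV :: bool set))"
    using assms by (intro finite_PiE_dflt) auto
  then show "finite (set_pmf (Pi_pmf A False (\<lambda>_. bernoulli_pmf q)))"
    by (rule rev_finite_subset) (auto simp: PiE_dflt_def set_Pi_pmf assms)
qed

lemma pexpect_add: "finite A \<Longrightarrow> pexpect A q (\<lambda>x. h x + k x) = pexpect A q h + pexpect A q k"
  and pexpect_diff: "finite A \<Longrightarrow> pexpect A q (\<lambda>x. h x - k x) = pexpect A q h - pexpect A q k"
  and pexpect_cmult: "pexpect A q (\<lambda>x. c * h x) = c * pexpect A q h"
  and pexpect_const: "pexpect A q (\<lambda>x. c) = c"
  and pexpect_sum: "finite A \<Longrightarrow>
        pexpect A q (\<lambda>x. \<Sum>i\<in>I. H i x) = (\<Sum>i\<in>I. pexpect A q (H i))"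
  by (auto simp: pexpect_def integrable_Pi_bernoulli)

text \<open>The comparison is required only on the support, since bounds on \<open>f\<close> and
  \<open>g\<close> are available only on \<open>cube n\<close>.\<close>

lemma pexpect_mono:
  assumes "finite A" "\<And>x. (\<And>i. i \<notin> A \<Longrightarrow> \<not> x i) \<Longrightarrow> h x \<le> k x"
  shows "pexpect A q h \<le> pexpect A q k"
  unfolding pexpect_def
proof (rule integral_mono_AE)
  show "AE x in measure_pmf (Pi_pmf A False (\<lambda>_. bernoulli_pmf q)). h x \<le> k x"
    using assms by (auto simp: AE_measure_pmf_iff set_Pi_pmf PiE_dflt_def)
qed (auto simp: integrable_Pi_bernoulli assms)

lemma pexpect_cong:
  assumes "finite A" "\<And>x. (\<And>i. i \<notin> A \<Longrightarrow> \<not> x i) \<Longrightarrow> h x = k x"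
  shows "pexpect A q h = pexpect A q k"
  using assms by (intro antisym pexpect_mono) auto

lemma pexpect_insert:
  assumes "finite A" "a \<notin> A" "0 \<le> q" "q \<le> 1"
  shows "pexpect (insert a A) q h =
    q * pexpect A q (\<lambda>x. h (x(a := True))) + (1 - q) * pexpect A q (\<lambda>x. h (x(a := False)))"
proof -
  let ?M = "Pi_pmf A False (\<lambda>_. bernoulli_pmf q)"
  have eq: "Pi_pmf (insert a A) False (\<lambda>_. bernoulli_pmf q)
      = bernoulli_pmf q \<bind> (\<lambda>b. map_pmf (\<lambda>x. x(a := b)) ?M)"
    using assms by (simp add: Pi_pmf_insert pair_pmf_def map_pmf_def bind_assoc_pmf bind_return_pmf)
  have "finite (set_pmf (Pi_pmf A False (\<lambda>_. bernoulli_pmf q)))"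
    using assms(1) by (auto simp: set_Pi_pmf intro!: finite_PiE_dflt)
  then have "measure_pmf.expectation (bernoulli_pmf q \<bind> (\<lambda>b. map_pmf (\<lambda>x. x(a := b)) ?M)) h =
     (\<Sum>b\<in>UNIV. pmf (bernoulli_pmf q) b *\<^sub>R measure_pmf.expectation (map_pmf (\<lambda>x. x(a := b)) ?M) h)"
    by (intro pmf_expectation_bind) auto
  also have "\<dots> = q * pexpect A q (\<lambda>x. h (x(a := True)))
      + (1 - q) * pexpect A q (\<lambda>x. h (x(a := False)))"
    using assms by (simp add: UNIV_bool pexpect_def)
  finally show ?thesis by (simp add: pexpect_def eq)
qed

text \<open>Conditioning on coordinate \<open>a\<close>: both integrands on the right overwrite
  \<open>x a\<close>, so the average may still be taken over all of \<open>A\<close>.\<close>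

lemma pexpect_fun_upd:
  assumes "finite A" "a \<in> A" "0 \<le> q" "q \<le> 1"
  shows "pexpect A q h =
    q * pexpect A q (\<lambda>x. h (x(a := True))) + (1 - q) * pexpect A q (\<lambda>x. h (x(a := False)))"
proof -
  obtain B where B: "A = insert a B" "a \<notin> B" "finite B"
    using assms by (metis finite_insert mk_disjoint_insert)
  show ?thesis
    using B assms(3,4) by (simp add: pexpect_insert algebra_simps)
qed

section \<open>Variance inequalities on the biased cube\<close>

lemma square_pexpect_le:
  assumes "finite A"
  shows "(pexpect A q h)\<^sup>2 \<le> pexpect A q (\<lambda>x. (h x)\<^sup>2)"
proof -
  let ?m = "pexpect A q h"
  have "0 \<le> pexpect A q (\<lambda>x. (h x - ?m)\<^sup>2)"
    using pexpect_mono[OF assms, of "\<lambda>_. 0"] by (simp add: pexpect_const)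
  also have "\<dots> = pexpect A q (\<lambda>x. (h x)\<^sup>2 - 2 * ?m * h x + ?m\<^sup>2)"
    by (simp add: power2_eq_square algebra_simps)
  also have "\<dots> = pexpect A q (\<lambda>x. (h x)\<^sup>2) - ?m\<^sup>2"
    using assms by (simp add: pexpect_add pexpect_diff pexpect_cmult pexpect_const power2_eq_square)
  finally show ?thesis by simp
qed

text \<open>Law of total variance: the conditional mean given coordinate \<open>a\<close> takes two
  values, and its variance is the last summand.\<close>

lemma pvar_insert:
  assumes "finite A" "a \<notin> A" "0 \<le> q" "q \<le> 1"
  shows "pvar (insert a A) q h =
    q * pvar A q (\<lambda>x. h (x(a := True))) + (1 - q) * pvar A q (\<lambda>x. h (x(a := False)))
    + q * (1 - q) * (pexpect A q (\<lambda>x. h (x(a := True)) - h (x(a := False))))\<^sup>2"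
  using assms
  by (simp add: pvar_def pexpect_insert pexpect_diff power2_eq_square algebra_simps)

lemma convex_square:
  fixes q a b :: real
  assumes "0 \<le> q" "q \<le> 1"
  shows "(q * a + (1 - q) * b)\<^sup>2 \<le> q * a\<^sup>2 + (1 - q) * b\<^sup>2"
proof -
  have "q * a\<^sup>2 + (1 - q) * b\<^sup>2 - (q * a + (1 - q) * b)\<^sup>2 = q * (1 - q) * (a - b)\<^sup>2"
    by (simp add: power2_eq_square algebra_simps)
  also have "\<dots> \<ge> 0" using assms by simp
  finally show ?thesis by simp
qed

text \<open>In the induction, the new direction contributes the square of an averaged difference,
  which Jensen bounds by the averaged square. In the old directions the averaged squares split
  exactly over the two values of the new coordinate.\<close>

lemma efron_stein:
  assumes "finite A" "0 \<le> q" "q \<le> 1"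
  shows "pvar A q h \<le>
    q * (1 - q) * (\<Sum>i\<in>A. pexpect A q (\<lambda>x. (h (x(i := True)) - h (x(i := False)))\<^sup>2))"
  using assms(1)
proof (induction A arbitrary: h rule: finite_induct)
  case empty
  show ?case by (simp add: pvar_def pexpect_def)
next
  case (insert a A)
  let ?D = "\<lambda>h i x. (h (x(i := True)) - h (x(i := False)) :: real)\<^sup>2"
  let ?h1 = "\<lambda>x. h (x(a := True))" and ?h0 = "\<lambda>x. h (x(a := False))"
  have tw: "x(i := b, a := c) = x(a := c, i := b)" if "i \<in> A" for x i b c
    using that insert.hyps by (auto simp: fun_upd_twist)
  have *: "pexpect (insert a A) q (?D h i) =
      q * pexpect A q (?D ?h1 i) + (1 - q) * pexpect A q (?D ?h0 i)" if "i \<in> A" for i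
    using insert.hyps assms that by (simp add: pexpect_insert tw)
  have **: "pexpect (insert a A) q (?D h a) = pexpect A q (?D h a)"
    using insert.hyps assms by (simp add: pexpect_insert algebra_simps)
  have sum_eq: "(\<Sum>i\<in>A. pexpect (insert a A) q (?D h i)) =
      q * (\<Sum>i\<in>A. pexpect A q (?D ?h1 i)) + (1 - q) * (\<Sum>i\<in>A. pexpect A q (?D ?h0 i))"
    by (simp add: * sum.distrib sum_distrib_left)
  have "pvar (insert a A) q h \<le>
      q * (q * (1 - q) * (\<Sum>i\<in>A. pexpect A q (?D ?h1 i)))
      + (1 - q) * (q * (1 - q) * (\<Sum>i\<in>A. pexpect A q (?D ?h0 i)))
      + q * (1 - q) * pexpect A q (?D h a)"
    unfolding pvar_insert[OF insert.hyps assms(2,3)]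
    using assms insert.hyps
    by (intro add_mono mult_left_mono insert.IH square_pexpect_le) auto
  also have "\<dots> = q * (1 - q) * (pexpect A q (?D h a)
      + (q * (\<Sum>i\<in>A. pexpect A q (?D ?h1 i)) + (1 - q) * (\<Sum>i\<in>A. pexpect A q (?D ?h0 i))))"
    by (simp only: algebra_simps)
  also have "\<dots> = q * (1 - q) * (\<Sum>i\<in>insert a A. pexpect (insert a A) q (?D h i))"
    by (simp only: sum.insert[OF insert.hyps] ** sum_eq)
  finally show ?case .
qed

text \<open>Bessel's inequality for the first-order Fourier coefficients of \<open>h\<close>.\<close>

lemma sum_square_influence_le_pvar:
  assumes "finite A" "0 \<le> q" "q \<le> 1"
  shows "q * (1 - q) * (\<Sum>i\<in>A. (pexpect A q (\<lambda>x. h (x(i := True)) - h (x(i := False))))\<^sup>2)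
    \<le> pvar A q h"
  using assms(1)
proof (induction A arbitrary: h rule: finite_induct)
  case empty
  show ?case by (simp add: pvar_def pexpect_def)
next
  case (insert a A)
  let ?D = "\<lambda>h i x. h (x(i := True)) - h (x(i := False)) :: real"
  let ?h1 = "\<lambda>x. h (x(a := True))" and ?h0 = "\<lambda>x. h (x(a := False))"
  have tw: "x(i := b, a := c) = x(a := c, i := b)" if "i \<in> A" for x i b c
    using that insert.hyps by (auto simp: fun_upd_twist)
  \<comment> \<open>Convexity now acts on the old directions, while the new direction matches the
    last term of \<open>pvar_insert\<close> exactly.\<close>
  have *: "(pexpect (insert a A) q (?D h i))\<^sup>2 \<le>
      q * (pexpect A q (?D ?h1 i))\<^sup>2 + (1 - q) * (pexpect A q (?D ?h0 i))\<^sup>2" if "i \<in> A" for i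
    using insert.hyps assms that by (simp add: pexpect_insert tw convex_square)
  have **: "pexpect (insert a A) q (?D h a) = pexpect A q (?D h a)"
    using insert.hyps assms by (simp add: pexpect_insert algebra_simps)
  have "q * (1 - q) * (\<Sum>i\<in>insert a A. (pexpect (insert a A) q (?D h i))\<^sup>2) =
      q * (1 - q) * (\<Sum>i\<in>A. (pexpect (insert a A) q (?D h i))\<^sup>2)
      + q * (1 - q) * (pexpect A q (?D h a))\<^sup>2"
    using insert.hyps by (simp add: ** algebra_simps)
  also have "\<dots> \<le> q * (1 - q) * (\<Sum>i\<in>A. q * (pexpect A q (?D ?h1 i))\<^sup>2
        + (1 - q) * (pexpect A q (?D ?h0 i))\<^sup>2)
      + q * (1 - q) * (pexpect A q (?D h a))\<^sup>2"
    using assms * by (intro add_mono mult_left_mono sum_mono order_refl) auto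
  also have "\<dots> = q * (q * (1 - q) * (\<Sum>i\<in>A. (pexpect A q (?D ?h1 i))\<^sup>2))
      + (1 - q) * (q * (1 - q) * (\<Sum>i\<in>A. (pexpect A q (?D ?h0 i))\<^sup>2))
      + q * (1 - q) * (pexpect A q (?D h a))\<^sup>2"
    by (simp only: sum.distrib sum_distrib_left[symmetric]) (simp only: algebra_simps)
  also have "\<dots> \<le> pvar (insert a A) q h"
    unfolding pvar_insert[OF insert.hyps assms(2,3)]
    using assms by (intro add_mono mult_left_mono insert.IH order_refl) auto
  finally show ?case .
qed

text \<open>The downward difference vanishes when \<open>x i\<close> is \<open>False\<close>, so its
  second moment is \<open>q\<close> times that of the full edge difference. This absorbs the factor
  \<open>q\<close> of Efron--Stein and charges every edge to its upper endpoint.\<close>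

lemma pvar_le_lower_gradient:
  assumes "finite A" "0 \<le> q" "q \<le> 1"
  shows "pvar A q h \<le> pexpect A q (\<lambda>x. \<Sum>i\<in>A. (h x - h (x(i := False)))\<^sup>2)"
proof -
  let ?G = "\<Sum>i\<in>A. pexpect A q (\<lambda>x. (h x - h (x(i := False)))\<^sup>2)"
  have *: "pexpect A q (\<lambda>x. (h x - h (x(i := False)))\<^sup>2) =
      q * pexpect A q (\<lambda>x. (h (x(i := True)) - h (x(i := False)))\<^sup>2)" if "i \<in> A" for i
    using pexpect_fun_upd[OF assms(1) that assms(2,3), of "\<lambda>x. (h x - h (x(i := False)))\<^sup>2"]
    by (simp add: pexpect_const)
  have "?G \<ge> 0"
    using pexpect_mono[OF assms(1), of "\<lambda>_. 0"] by (intro sum_nonneg) (simp add: pexpect_const)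
  have "pvar A q h \<le> (1 - q) * ?G"
    using efron_stein[OF assms, of h] by (simp add: * sum_distrib_left mult_ac)
  also have "\<dots> \<le> ?G"
    using \<open>?G \<ge> 0\<close> assms mult_right_mono[of "1 - q" 1 ?G] by simp
  finally show ?thesis by (simp add: pexpect_sum assms)
qed

text \<open>The mean minimises the expected squared deviation, so \<open>g\<close> may be compared
  with the mean of \<open>h\<close>; then split the deviation as
  \<open>(h - ?m) + (g - h)\<close>.\<close>

lemma pvar_le_double:
  assumes "finite A"
  shows "pvar A q g \<le> 2 * pvar A q h + 2 * pexpect A q (\<lambda>x. (h x - g x)\<^sup>2)"
proof -
  let ?E = "pexpect A q" and ?m = "pexpect A q h"
  have "pvar A q g \<le> ?E (\<lambda>x. (g x - ?m)\<^sup>2)"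
  proof -
    have "?E (\<lambda>x. (g x - ?m)\<^sup>2) = ?E (\<lambda>x. (g x)\<^sup>2 - 2 * ?m * g x + ?m\<^sup>2)"
      by (simp add: power2_eq_square algebra_simps)
    also have "\<dots> = pvar A q g + (?E g - ?m)\<^sup>2"
      using assms by (simp add: pvar_def pexpect_add pexpect_diff pexpect_cmult pexpect_const
          power2_diff)
    finally show ?thesis by simp
  qed
  also have "\<dots> \<le> ?E (\<lambda>x. 2 * ((h x)\<^sup>2 - 2 * ?m * h x + ?m\<^sup>2) + 2 * (h x - g x)\<^sup>2)"
  proof (rule pexpect_mono[OF assms])
    fix x
    have "2 * ((h x)\<^sup>2 - 2 * ?m * h x + ?m\<^sup>2) + 2 * (h x - g x)\<^sup>2 - (g x - ?m)\<^sup>2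
        = (2 * h x - ?m - g x)\<^sup>2"
      by (simp add: power2_eq_square algebra_simps)
    then show "(g x - ?m)\<^sup>2 \<le> 2 * ((h x)\<^sup>2 - 2 * ?m * h x + ?m\<^sup>2) + 2 * (h x - g x)\<^sup>2"
      by (metis diff_ge_0_iff_ge zero_le_power2)
  qed
  also have "\<dots> = 2 * pvar A q h + 2 * ?E (\<lambda>x. (h x - g x)\<^sup>2)"
    using assms by (simp add: pvar_def pexpect_add pexpect_diff pexpect_cmult pexpect_const
        power2_eq_square)
  finally show ?thesis .
qed

section \<open>The one-sided noise operator\<close>

text \<open>The conjunction of independent bits of biases \<open>p\<close> and \<rho> is a bit of
  bias \<open>\<rho> * p\<close>; this is applied one coordinate at a time.\<close>

lemma pexpect_and:
  assumes "finite A" "0 \<le> p" "p \<le> 1" "0 \<le> \<rho>" "\<rho> \<le> 1"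
  shows "pexpect A p (\<lambda>x. pexpect A \<rho> (\<lambda>z. f (\<lambda>i. x i \<and> z i))) = pexpect A (\<rho> * p) f"
  using assms(1)
proof (induction A arbitrary: f rule: finite_induct)
  case empty
  show ?case by (simp add: pexpect_def)
next
  case (insert a A)
  have upd: "(\<lambda>i. (x(a := b)) i \<and> (z(a := c)) i) = (\<lambda>i. x i \<and> z i)(a := b \<and> c)"
    for x z :: "'a \<Rightarrow> bool" and b c by auto
  have "\<rho> * p \<le> 1" "0 \<le> \<rho> * p"
    using assms by (auto simp: mult_le_one)
  then show ?case
    using insert.hyps assms
    by (simp add: pexpect_insert pexpect_add pexpect_cmult upd
        insert.IH[of "\<lambda>x. f (x(a := b))" for b] del: fun_upd_apply)
      (simp add: algebra_simps)
qed

lemma expect_eq_pexpect: "expect n q = pexpect {..<n} q"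
  by (simp add: expect_def pexpect_def biased_def fun_eq_iff)

lemma cube_iff: "x \<in> cube n \<longleftrightarrow> (\<forall>i. i \<notin> {..<n} \<longrightarrow> \<not> x i)"
  by (auto simp: cube_def PiE_dflt_def)

lemma and_noise_bounds:
  assumes "\<And>x. x \<in> cube n \<Longrightarrow> f x \<in> {0..1}" "x \<in> cube n"
  shows "and_noise n \<rho> f x \<in> {0..1}"
proof -
  have "f (\<lambda>i. x i \<and> z i) \<in> {0..1}" for z
    using assms by (auto simp: cube_iff)
  then show ?thesis
    using pexpect_mono[of "{..<n}" "\<lambda>_. 0" "\<lambda>z. f (\<lambda>i. x i \<and> z i)" \<rho>]
      pexpect_mono[of "{..<n}" "\<lambda>z. f (\<lambda>i. x i \<and> z i)" "\<lambda>_. 1" \<rho>]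
    by (simp add: and_noise_def expect_eq_pexpect pexpect_const)
qed

text \<open>Condition on \<open>z i\<close>: a \<open>False\<close> noise bit has the same effect as
  erasing bit \<open>i\<close> of \<open>x\<close> beforehand.\<close>

lemma and_noise_fun_upd:
  assumes "i < n" "x i" "0 \<le> \<rho>" "\<rho> \<le> 1"
  shows "and_noise n \<rho> f x =
    \<rho> * pexpect {..<n} \<rho> (\<lambda>z. f (\<lambda>j. x j \<and> (z(i := True)) j))
    + (1 - \<rho>) * and_noise n \<rho> f (x(i := False))"
    and "and_noise n \<rho> f (x(i := False)) =
      pexpect {..<n} \<rho> (\<lambda>z. f (\<lambda>j. x j \<and> (z(i := False)) j))"
proof -
  have "(\<lambda>j. x j \<and> (z(i := False)) j) = (\<lambda>j. (x(i := False)) j \<and> z j)" for z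
    by auto
  then show **: "and_noise n \<rho> f (x(i := False)) =
      pexpect {..<n} \<rho> (\<lambda>z. f (\<lambda>j. x j \<and> (z(i := False)) j))"
    by (simp add: and_noise_def expect_eq_pexpect)
  show "and_noise n \<rho> f x = \<rho> * pexpect {..<n} \<rho> (\<lambda>z. f (\<lambda>j. x j \<and> (z(i := True)) j))
    + (1 - \<rho>) * and_noise n \<rho> f (x(i := False))"
    unfolding ** unfolding and_noise_def expect_eq_pexpect
    using assms by (subst pexpect_fun_upd[where a = i]) simp_all
qed

text \<open>The part of the average with \<open>z i\<close> equal to \<open>True\<close> has weight
  \<rho> and a value in the unit interval; the two bounds put 0 and 1 in its place.\<close>

lemma and_noise_lower_edge:
  assumes "\<And>x. x \<in> cube n \<Longrightarrow> f x \<in> {0..1}" "x \<in> cube n" "i < n" "x i" "0 \<le> \<rho>" "\<rho> \<le> 1"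
  shows "(1 - \<rho>) * and_noise n \<rho> f (x(i := False)) \<le> and_noise n \<rho> f x"
    and "and_noise n \<rho> f x \<le> \<rho> + (1 - \<rho>) * and_noise n \<rho> f (x(i := False))"
proof -
  let ?B = "pexpect {..<n} \<rho> (\<lambda>z. f (\<lambda>j. x j \<and> (z(i := True)) j))"
  have "f (\<lambda>j. x j \<and> (z(i := True)) j) \<in> {0..1}" for z
    using assms(1,2) by (auto simp: cube_iff)
  then have "0 \<le> ?B" "?B \<le> 1"
    using pexpect_mono[of "{..<n}" "\<lambda>_. 0" "\<lambda>z. f (\<lambda>j. x j \<and> (z(i := True)) j)" \<rho>]
      pexpect_mono[of "{..<n}" "\<lambda>z. f (\<lambda>j. x j \<and> (z(i := True)) j)" "\<lambda>_. 1" \<rho>]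
    by (simp_all add: pexpect_const)
  then have "0 \<le> \<rho> * ?B" "\<rho> * ?B \<le> \<rho>"
    using assms(5) mult_left_le[of ?B \<rho>] by simp_all
  then show "(1 - \<rho>) * and_noise n \<rho> f (x(i := False)) \<le> and_noise n \<rho> f x"
    and "and_noise n \<rho> f x \<le> \<rho> + (1 - \<rho>) * and_noise n \<rho> f (x(i := False))"
    unfolding and_noise_fun_upd(1)[of i n x \<rho> f, OF assms(3-6)] by linarith+
qed

text \<open>Each nonzero difference is \<rho> times the averaged edge difference of
  \<open>z \<mapsto> f (x \<and> z)\<close>. The factor \<open>\<rho>\<^sup>2\<close>, divided by
  the weight \<open>\<rho> * (1 - \<rho>)\<close> in Bessel's inequality, gives a bound free of
  \<open>n\<close>.\<close>

lemma and_noise_gradient: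
  assumes f: "\<And>x. x \<in> cube n \<Longrightarrow> f x \<in> {0..1}" and x: "x \<in> cube n" and \<rho>: "0 < \<rho>" "\<rho> < 1"
  shows "(\<Sum>i<n. (and_noise n \<rho> f x - and_noise n \<rho> f (x(i := False)))\<^sup>2) \<le> \<rho> / (1 - \<rho>)"
proof -
  define h where "h z = f (\<lambda>j. x j \<and> z j)" for z
  let ?D = "\<lambda>i. pexpect {..<n} \<rho> (\<lambda>z. h (z(i := True)) - h (z(i := False)))"
  have "(and_noise n \<rho> f x - and_noise n \<rho> f (x(i := False)))\<^sup>2 \<le> \<rho>\<^sup>2 * (?D i)\<^sup>2" if "i < n" for i
  proof (cases "x i")
    case True
    then have "and_noise n \<rho> f x - and_noise n \<rho> f (x(i := False)) = \<rho> * ?D i"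
      using and_noise_fun_upd[of i n x \<rho> f] that \<rho>
      by (simp add: pexpect_diff h_def algebra_simps)
    then show ?thesis by (simp add: power_mult_distrib)
  next
    case False
    then have "x(i := False) = x" by (auto simp: fun_eq_iff)
    then show ?thesis by simp
  qed
  then have "(\<Sum>i<n. (and_noise n \<rho> f x - and_noise n \<rho> f (x(i := False)))\<^sup>2)
      \<le> \<rho>\<^sup>2 * (\<Sum>i<n. (?D i)\<^sup>2)"
    unfolding sum_distrib_left by (intro sum_mono) auto
  also have "\<dots> = \<rho> / (1 - \<rho>) * (\<rho> * (1 - \<rho>) * (\<Sum>i<n. (?D i)\<^sup>2))"
    using \<rho> by (simp add: field_simps power2_eq_square)
  also have "\<dots> \<le> \<rho> / (1 - \<rho>) * 1"
  proof (rule mult_left_mono)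
    have "(h z)\<^sup>2 \<le> 1" for z
      using f[of "\<lambda>j. x j \<and> z j"] x by (auto simp: h_def cube_iff abs_square_le_1)
    then have "pexpect {..<n} \<rho> (\<lambda>z. (h z)\<^sup>2) \<le> 1"
      using pexpect_mono[of "{..<n}" "\<lambda>z. (h z)\<^sup>2" "\<lambda>_. 1" \<rho>] by (simp add: pexpect_const)
    then have "pvar {..<n} \<rho> h \<le> 1"
      unfolding pvar_def using zero_le_power2[of "pexpect {..<n} \<rho> h"] by linarith
    then show "\<rho> * (1 - \<rho>) * (\<Sum>i<n. (?D i)\<^sup>2) \<le> 1"
      using sum_square_influence_le_pvar[of "{..<n}" \<rho> h] \<rho> by simp
  qed (use \<rho> in auto)
  finally show ?thesis by simp
qed

section \<open>The Lipschitz cutoff\<close>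

text \<open>A ramp of slope \<open>2 / \<zeta>\<close> rising from 0 at \<open>\<zeta> / 4\<close>
  to 1 at \<open>3 * \<zeta> / 4\<close>, which leaves a margin of \<open>\<zeta> / 4\<close> next
  to both 0 and \<zeta>.\<close>

definition cutoff :: "real \<Rightarrow> real \<Rightarrow> real" where
  "cutoff \<zeta> t = max 0 (min 1 (2 * t / \<zeta> - 1 / 2))"

lemma cutoff_bounds: "0 \<le> cutoff \<zeta> t" "cutoff \<zeta> t \<le> 1"
  by (auto simp: cutoff_def)

lemma cutoff_eq_0: "\<zeta> > 0 \<Longrightarrow> t \<le> \<zeta> / 4 \<Longrightarrow> cutoff \<zeta> t = 0"
  and cutoff_eq_1: "\<zeta> > 0 \<Longrightarrow> t \<ge> 3 * \<zeta> / 4 \<Longrightarrow> cutoff \<zeta> t = 1"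
  by (auto simp: cutoff_def field_simps max_def min_def)

lemma cutoff_lipschitz:
  assumes "\<zeta> > 0"
  shows "(cutoff \<zeta> s - cutoff \<zeta> t)\<^sup>2 \<le> 4 / \<zeta>\<^sup>2 * (s - t)\<^sup>2"
proof -
  have "\<bar>cutoff \<zeta> s - cutoff \<zeta> t\<bar> \<le> \<bar>2 * s / \<zeta> - 2 * t / \<zeta>\<bar>"
    unfolding cutoff_def by linarith
  then have "(cutoff \<zeta> s - cutoff \<zeta> t)\<^sup>2 \<le> (2 * s / \<zeta> - 2 * t / \<zeta>)\<^sup>2"
    by (simp add: abs_le_square_iff)
  also have "\<dots> = 4 / \<zeta>\<^sup>2 * (s - t)\<^sup>2"
    using assms by (simp add: field_simps power2_eq_square)
  finally show ?thesis .
qed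

section \<open>Comparison of \<open>g\<close> with the cutoff of the noisy function\<close>

context
  fixes n :: nat and \<zeta> \<rho> lam :: real and f g :: "(nat \<Rightarrow> bool) \<Rightarrow> real"
  assumes \<zeta>: "\<zeta> > 0" and \<rho>: "\<rho> \<in> {\<zeta>..1 - \<zeta>}" and lam: "lam \<ge> \<rho> + \<zeta>"
    and f: "\<And>x. x \<in> cube n \<Longrightarrow> f x \<in> {0..1}" and g: "\<And>x. x \<in> cube n \<Longrightarrow> g x \<in> {0, 1}"
begin

text \<open>Erasing a bit can enlarge a small value by the factor
  \<open>1 / (1 - \<rho>) \<le> 1 / \<zeta>\<close>, so the tolerance
  \<open>\<zeta>\<^sup>2 / 4\<close> at \<open>x\<close> becomes the margin
  \<open>\<zeta> / 4\<close> of the cutoff at the lower endpoint.\<close>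

lemma cutoff_and_noise_eq:
  assumes "x \<in> cube n" "\<bar>and_noise n \<rho> f x - lam * g x\<bar> \<le> \<zeta>\<^sup>2 / 4"
  shows "cutoff \<zeta> (and_noise n \<rho> f x) = g x"
    and "i < n \<Longrightarrow> cutoff \<zeta> (and_noise n \<rho> f (x(i := False))) = g x"
proof -
  let ?F = "and_noise n \<rho> f"
  \<comment> \<open>The interval containing \<rho> is nonempty, which forces \<zeta> to be at most
    1/2.\<close>
  have z2: "\<zeta>\<^sup>2 \<le> \<zeta>" "\<zeta> \<le> 1 / 2"
    using \<zeta> \<rho> by (auto simp: power2_eq_square mult_le_one)
  have e0: "\<bar>?F x\<bar> \<le> \<zeta>\<^sup>2 / 4" if "g x = 0"
    using assms(2) that by simp
  have e1: "\<bar>?F x - lam\<bar> \<le> \<zeta>\<^sup>2 / 4" if "g x = 1"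
    using assms(2) that by simp
  have "?F x \<le> \<zeta> / 4" if "g x = 0"
    using e0[OF that] z2 by linarith
  moreover have "\<rho> \<ge> 0"
    using \<rho> \<zeta> by simp
  then have "?F x \<ge> 3 * \<zeta> / 4" if "g x = 1"
    using e1[OF that] z2 lam by linarith
  ultimately show eq: "cutoff \<zeta> (?F x) = g x"
    using g[OF assms(1)] \<zeta> by (auto simp: cutoff_eq_0 cutoff_eq_1)
  assume "i < n"
  show "cutoff \<zeta> (?F (x(i := False))) = g x"
  proof (cases "x i")
    case False
    then have "x(i := False) = x" by (auto simp: fun_eq_iff)
    then show ?thesis using eq by simp
  next
    case True
    let ?A = "?F (x(i := False))"
    have "x(i := False) \<in> cube n"
      using assms(1) by (auto simp: cube_iff)
    then have A: "0 \<le> ?A"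
      using and_noise_bounds[of n f, OF f] by auto
    have lo: "(1 - \<rho>) * ?A \<le> ?F x" and hi: "?F x \<le> \<rho> + (1 - \<rho>) * ?A"
      using and_noise_lower_edge[of n f x i \<rho>] f assms(1) \<open>i < n\<close> True \<rho> \<zeta> by auto
    have up: "\<zeta> * ?A \<le> (1 - \<rho>) * ?A" "(1 - \<rho>) * ?A \<le> ?A"
      using A \<rho> \<zeta> by (auto intro: mult_right_mono mult_left_le_one_le)
    have "?A \<le> \<zeta> / 4" if "g x = 0"
    proof -
      have "\<zeta> * ?A \<le> \<zeta>\<^sup>2 / 4"
        using e0[OF that] lo up by linarith
      then show ?thesis using \<zeta> by (simp add: power2_eq_square)
    qed
    \<comment> \<open>Here \<open>\<rho> + ?A \<ge> ?F x \<ge> lam - \<zeta> / 4\<close>, and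
      \<open>lam\<close> exceeds \<rho> by at least \<zeta>.\<close>
    moreover have "?A \<ge> 3 * \<zeta> / 4" if "g x = 1"
      using e1[OF that] hi up z2 lam by linarith
    ultimately show ?thesis
      using g[OF assms(1)] \<zeta> by (auto simp: cutoff_eq_0 cutoff_eq_1)
  qed
qed

text \<open>Markov's inequality in pointwise form: the sum vanishes at good points, and at bad
  points it is at most \<open>4 / \<zeta> ^ 3\<close> while the error exceeds
  \<open>\<zeta>\<^sup>2 / 4\<close>.\<close>

lemma cutoff_gradient:
  assumes "x \<in> cube n"
  shows "(\<Sum>i<n. (cutoff \<zeta> (and_noise n \<rho> f x) - cutoff \<zeta> (and_noise n \<rho> f (x(i := False))))\<^sup>2)
    \<le> 16 / \<zeta> ^ 5 * \<bar>and_noise n \<rho> f x - lam * g x\<bar>" (is "?S \<le> _ * ?e")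
proof (cases "?e \<le> \<zeta>\<^sup>2 / 4")
  case True
  then show ?thesis
    using cutoff_and_noise_eq[OF assms True] \<zeta> by simp
next
  case False
  let ?F = "and_noise n \<rho> f"
  have "?S \<le> (\<Sum>i<n. 4 / \<zeta>\<^sup>2 * (?F x - ?F (x(i := False)))\<^sup>2)"
    by (intro sum_mono cutoff_lipschitz \<zeta>)
  also have "\<dots> = 4 / \<zeta>\<^sup>2 * (\<Sum>i<n. (?F x - ?F (x(i := False)))\<^sup>2)"
    by (simp add: sum_distrib_left)
  also have "\<dots> \<le> 4 / \<zeta>\<^sup>2 * (1 / \<zeta>)"
  proof (intro mult_left_mono)
    have "\<rho> / (1 - \<rho>) \<le> 1 / \<zeta>"
      using \<rho> \<zeta> by (intro frac_le) auto
    then show "(\<Sum>i<n. (?F x - ?F (x(i := False)))\<^sup>2) \<le> 1 / \<zeta>"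
      using and_noise_gradient[of n f x \<rho>, OF f assms] \<rho> \<zeta> by simp
  qed auto
  also have "\<dots> = 16 / \<zeta> ^ 5 * (\<zeta>\<^sup>2 / 4)"
    using \<zeta> by (simp add: field_simps power2_eq_square eval_nat_numeral)
  also have "\<dots> \<le> 16 / \<zeta> ^ 5 * ?e"
    using False \<zeta> by (intro mult_left_mono) auto
  finally show ?thesis .
qed

text \<open>The same dichotomy, with the trivial bound 1 at bad points.\<close>

lemma cutoff_error:
  assumes "x \<in> cube n"
  shows "(cutoff \<zeta> (and_noise n \<rho> f x) - g x)\<^sup>2 \<le> 4 / \<zeta>\<^sup>2 * \<bar>and_noise n \<rho> f x - lam * g x\<bar>"
    (is "?d\<^sup>2 \<le> _ * ?e")
proof (cases "?e \<le> \<zeta>\<^sup>2 / 4")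
  case True
  then show ?thesis
    using cutoff_and_noise_eq[OF assms True] \<zeta> by simp
next
  case False
  have "\<bar>?d\<bar> \<le> 1"
    using g[OF assms] cutoff_bounds[of \<zeta> "and_noise n \<rho> f x"] by auto
  then have "?d\<^sup>2 \<le> 1"
    by (simp add: abs_square_le_1)
  also have "1 = 4 / \<zeta>\<^sup>2 * (\<zeta>\<^sup>2 / 4)"
    using \<zeta> by simp
  also have "\<dots> \<le> 4 / \<zeta>\<^sup>2 * ?e"
    using False by (intro mult_left_mono) auto
  finally show ?thesis .
qed

lemma pvar_le_L1_norm:
  assumes "0 \<le> p" "p \<le> 1"
  shows "pvar {..<n} p g \<le> 40 / \<zeta> ^ 5 * L1_norm n p (\<lambda>x. and_noise n \<rho> f x - lam * g x)"
    (is "_ \<le> _ * ?L")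
proof -
  let ?E = "pexpect {..<n} p" and ?e = "\<lambda>x. \<bar>and_noise n \<rho> f x - lam * g x\<bar>"
  let ?H = "\<lambda>x. cutoff \<zeta> (and_noise n \<rho> f x)"
  have L: "?L = ?E ?e" "?L \<ge> 0"
    using pexpect_mono[of "{..<n}" "\<lambda>_. 0" ?e p]
    by (simp_all add: L1_norm_def expect_eq_pexpect pexpect_const)
  have "pvar {..<n} p ?H \<le> ?E (\<lambda>x. 16 / \<zeta> ^ 5 * ?e x)"
    using assms
    by (intro order_trans[OF pvar_le_lower_gradient] pexpect_mono cutoff_gradient)
      (auto simp: cube_iff)
  moreover have "?E (\<lambda>x. (?H x - g x)\<^sup>2) \<le> ?E (\<lambda>x. 4 / \<zeta>\<^sup>2 * ?e x)"
    by (intro pexpect_mono cutoff_error) (auto simp: cube_iff)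
  ultimately have "pvar {..<n} p g \<le> 2 * (16 / \<zeta> ^ 5 * ?L) + 2 * (4 / \<zeta>\<^sup>2 * ?L)"
    using pvar_le_double[of "{..<n}" p g ?H, OF finite_lessThan]
    unfolding pexpect_cmult L(1) by linarith
  \<comment> \<open>Since \<zeta> is below 1, both terms can share the power
    \<open>\<zeta> ^ 5\<close>, and 2 * 16 + 2 * 4 = 40.\<close>
  also have "4 / \<zeta>\<^sup>2 * ?L \<le> 4 / \<zeta> ^ 5 * ?L"
    using \<zeta> \<rho> L(2) by (intro mult_right_mono divide_left_mono power_decreasing) auto
  finally show ?thesis by (simp add: algebra_simps)
qed

section \<open>From small variance to a constant\<close>

text \<open>As \<open>g\<close> is 0/1-valued with mean \<open>q\<close>, its variance is
  \<open>q * (1 - q)\<close>, so \<open>q\<close> is near 0 or 1. Noise preserves the mean, which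
  places the mean of \<open>f\<close> near \<open>lam * q\<close>; it remains to replace
  \<open>q\<close> by the constant even when \<open>lam\<close> is large.\<close>

lemma close_to_const_and_expect:
  assumes p: "0 \<le> p" "p \<le> 1" and \<epsilon>: "\<epsilon> > 0"
    and L: "L1_norm n p (\<lambda>x. and_noise n \<rho> f x - lam * g x) \<le> min 1 (\<epsilon> * \<zeta> ^ 5 / 400)"
  shows "\<exists>\<Gamma>\<in>{0, 1}. close_to_const n p \<epsilon> g \<Gamma> \<and> \<bar>expect n (\<rho> * p) f - lam * \<Gamma>\<bar> \<le> \<epsilon>"
proof -
  let ?E = "pexpect {..<n} p" and ?F = "and_noise n \<rho> f"
  let ?e = "\<lambda>x. \<bar>?F x - lam * g x\<bar>"
  define \<eta> where "\<eta> = ?E ?e"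
  define q where "q = ?E g"
  have "\<zeta> \<le> 1 / 2" and lam0: "lam > 0"
    using \<zeta> \<rho> lam by auto
  then have z5: "\<zeta> ^ 5 \<le> 1"
    using \<zeta> by (simp add: power_le_one)
  have "\<eta> \<le> 1" "\<eta> \<le> \<epsilon> * \<zeta> ^ 5 / 400"
    using L by (simp_all add: L1_norm_def expect_eq_pexpect \<eta>_def)
  moreover have "\<epsilon> * \<zeta> ^ 5 \<le> \<epsilon>"
    using mult_left_le[OF z5, of \<epsilon>] \<epsilon> by simp
  ultimately have \<eta>: "\<eta> \<le> 1" "\<eta> \<le> \<epsilon> * \<zeta> ^ 5 / 400" "\<eta> \<le> \<epsilon> / 400"
    by linarith+
  have g01: "0 \<le> g x" "g x \<le> 1" if "\<And>i. i \<notin> {..<n} \<Longrightarrow> \<not> x i" for x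
    using g[of x] that by (auto simp: cube_iff)
  have q01: "0 \<le> q" "q \<le> 1"
    using pexpect_mono[of "{..<n}" "\<lambda>_. 0" g p, OF finite_lessThan g01(1)]
      pexpect_mono[of "{..<n}" g "\<lambda>_. 1" p, OF finite_lessThan g01(2)]
    by (simp_all add: q_def pexpect_const)
  have "?E (\<lambda>x. (g x)\<^sup>2) = q"
    unfolding q_def using g by (intro pexpect_cong) (auto simp: cube_iff power2_eq_square)
  then have "q * (1 - q) = pvar {..<n} p g"
    by (simp add: pvar_def q_def power2_eq_square algebra_simps)
  also have "\<dots> \<le> 40 / \<zeta> ^ 5 * \<eta>"
    using pvar_le_L1_norm[OF p] by (simp add: L1_norm_def expect_eq_pexpect \<eta>_def)
  also have "\<dots> \<le> 40 / \<zeta> ^ 5 * (\<epsilon> * \<zeta> ^ 5 / 400)"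
    using \<eta> \<zeta> by (intro mult_left_mono) auto
  also have "\<dots> = \<epsilon> / 10"
    using \<zeta> by simp
  finally have q: "q * (1 - q) \<le> \<epsilon> / 10" .
  have mean: "?E ?F = expect n (\<rho> * p) f"
    using pexpect_and[of "{..<n}" p \<rho> f] p \<rho> \<zeta>
    by (simp add: and_noise_def[abs_def] expect_eq_pexpect)
  have "?E (\<lambda>x. ?F x - lam * g x) \<le> \<eta>" "?E (\<lambda>x. lam * g x - ?F x) \<le> \<eta>"
    unfolding \<eta>_def by (intro pexpect_mono; simp)+
  then have diff: "\<bar>expect n (\<rho> * p) f - lam * q\<bar> \<le> \<eta>"
    by (simp add: pexpect_diff pexpect_cmult mean q_def)
  have F: "0 \<le> ?F x" "?F x \<le> 1" if "x \<in> cube n" for x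
    using and_noise_bounds[of n f x \<rho>, OF f that] by auto
  have F1: "expect n (\<rho> * p) f \<le> 1"
    using pexpect_mono[of "{..<n}" ?F "\<lambda>_. 1" p] F by (simp add: mean pexpect_const cube_iff)
  have prob: "measure_pmf.prob (biased n p) {x. g x \<noteq> \<Gamma>} = ?E (indicator {x. g x \<noteq> \<Gamma>})" for \<Gamma>
    by (simp add: pexpect_def biased_def)
  show ?thesis
  proof (cases "q \<le> 1 / 2")
    case True
    have "q * (1 / 2) \<le> q * (1 - q)"
      using True q01 by (intro mult_left_mono) auto
    then have qe: "q \<le> \<epsilon> / 5"
      using q by simp
    have "?E (indicator {x. g x \<noteq> 0}) = q"
      unfolding q_def using g by (intro pexpect_cong) (auto simp: cube_iff indicator_def)
    \<comment> \<open>\<open>lam\<close> is not bounded above, so \<open>q\<close> being small does not suffice here.\<close>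
    moreover have "lam * q \<le> 2 * \<epsilon> / 5"
    proof (cases "lam \<le> 2")
      case True
      then have "lam * q \<le> 2 * q"
        using q01 by (intro mult_right_mono) auto
      then show ?thesis using qe by simp
    next
      case False
      have "?E (\<lambda>x. lam * g x) \<le> ?E (\<lambda>x. 2 * ?e x)"
      proof (rule pexpect_mono)
        fix x :: "nat \<Rightarrow> bool"
        assume "\<And>i. i \<notin> {..<n} \<Longrightarrow> \<not> x i"
        then have x: "x \<in> cube n" by (auto simp: cube_iff)
        \<comment> \<open>If \<open>g x = 1\<close>, then \<open>?F x \<le> 1 < lam / 2\<close>, so
          the error alone is at least \<open>lam / 2\<close>.\<close>
        show "lam * g x \<le> 2 * ?e x"
          using g[OF x] F[OF x] False by auto
      qed simp
      then have "lam * q \<le> 2 * \<eta>"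
        by (simp only: pexpect_cmult q_def \<eta>_def)
      then show ?thesis using \<eta> \<epsilon> by simp
    qed
    moreover have "0 \<le> lam * q" using lam0 q01 by simp
    ultimately have "close_to_const n p \<epsilon> g 0 \<and> \<bar>expect n (\<rho> * p) f - lam * 0\<bar> \<le> \<epsilon>"
      using diff qe \<epsilon> \<eta> unfolding close_to_const_def prob by auto
    then show ?thesis by blast
  next
    case False
    have "1 / 2 * (1 - q) \<le> q * (1 - q)"
      using False q01 by (intro mult_right_mono) auto
    then have qe: "1 - q \<le> \<epsilon> / 5"
      using q by simp
    have "?E (indicator {x. g x \<noteq> 1}) = ?E (\<lambda>x. 1 - g x)"
      using g by (intro pexpect_cong) (auto simp: cube_iff indicator_def)
    also have "\<dots> = 1 - q"
      by (simp add: pexpect_diff pexpect_const q_def)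
    finally have "?E (indicator {x. g x \<noteq> 1}) = 1 - q" .
    moreover have "lam * (1 / 2) \<le> lam * q"
      using False lam0 by (intro mult_left_mono) auto
    \<comment> \<open>\<open>lam / 2 \<le> lam * q \<le> 1 + \<eta> \<le> 2\<close>; this is where
      the cap 1 on the error enters.\<close>
    then have "lam \<le> 4"
      using diff F1 \<eta> by linarith
    then have "lam * (1 - q) \<le> 4 * (1 - q)"
      using q01 by (intro mult_right_mono) auto
    then have "lam - lam * q \<le> 4 * \<epsilon> / 5"
      using qe by (simp add: algebra_simps)
    moreover have "0 \<le> lam * (1 - q)" using lam0 q01 by simp
    then have "lam * q \<le> lam" by (simp add: algebra_simps)
    ultimately have "close_to_const n p \<epsilon> g 1 \<and> \<bar>expect n (\<rho> * p) f - lam * 1\<bar> \<le> \<epsilon>"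
      using diff qe \<epsilon> \<eta> unfolding close_to_const_def prob by auto
    then show ?thesis by blast
  qed
qed

end

theorem theorem2p7:
  fixes \<zeta> \<epsilon> :: real
  assumes "\<zeta> > 0" and "\<epsilon> > 0"
  shows "\<exists>\<eta>>0. \<forall>(n::nat) (\<rho>::real) (p::real) (lam::real)
            (f :: (nat \<Rightarrow> bool) \<Rightarrow> real) (g :: (nat \<Rightarrow> bool) \<Rightarrow> real).
          \<rho> \<in> {\<zeta>..1 - \<zeta>} \<longrightarrow> p \<in> {\<zeta>..1 - \<zeta>} \<longrightarrow> lam \<ge> \<rho> + \<zeta> \<longrightarrow>
          (\<forall>x\<in>cube n. f x \<in> {0..1}) \<longrightarrow> (\<forall>x\<in>cube n. g x \<in> {0, 1}) \<longrightarrow>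
          L1_norm n p (\<lambda>x. and_noise n \<rho> f x - lam * g x) \<le> \<eta> \<longrightarrow>
          (\<exists>\<Gamma>\<in>{0, 1}. close_to_const n p \<epsilon> g \<Gamma> \<and>
             \<bar>expect n (\<rho> * p) f - lam * \<Gamma>\<bar> \<le> \<epsilon>)"
\<comment> \<open>With the variance constant \<open>40 / \<zeta> ^ 5\<close>, the second entry makes
  the variance of \<open>g\<close> at most \<open>\<epsilon> / 10\<close>.\<close>
proof (intro exI[of _ "min 1 (\<epsilon> * \<zeta> ^ 5 / 400)"] conjI allI impI)
  show "0 < min 1 (\<epsilon> * \<zeta> ^ 5 / 400)"
    using assms by simp
qed (rule close_to_const_and_expect[OF assms(1)]; use assms in auto)

end
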